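(* Let $G$ be a graph with $n$ vertices, let $A$ be its adjacency matrix and $A_1$ the adjacency matrix of its line graph $L_1(G)$, and write $\det(xI_n-L(G))=\sum_{k=0}^n(-1)^{n-k}c_kx^k$. Then: (1) $c_{n-1}(G)=\operatorname{Tr}A^2$ and $c_{n-2}(G)=\frac12\big[\prod_{i=0}^1(\operatorname{Tr}A^2-2i)-\operatorname{Tr}A_1^2\big]$. (2) $c_{n-3}(G)=\frac{1}{3!}\big[\prod_{i=0}^2(\operatorname{Tr}A^2-2i)-3\operatorname{Tr}A^2\operatorname{Tr}A_1^2+\operatorname{Tr}(12A_1^2+2A_1^3)-4\operatorname{Tr}A^3\big]$. (3) If $G$ is a forest, $c_{n-4}(G)=\frac{1}{4!}\big[\prod_{i=0}^3(\operatorname{Tr}A^2-2i)-6(\operatorname{Tr}A^2)^2\operatorname{Tr}A_1^2+\operatorname{Tr}A^2\operatorname{Tr}(60A_1^2+8A_1^3)-\operatorname{Tr}(144A_1^2+48A_1^3+6A_1^4)+3(\operatorname{Tr}A_1^2)^2\big]$. (4) If $G$ is a forest, $c_{n-5}(G)=\frac{1}{5!}\big[\prod_{i=0}^4(\operatorname{Tr}A^2-2i)-10(\operatorname{Tr}A^2)^3\operatorname{Tr}A_1^2+(\operatorname{Tr}A^2)^2\operatorname{Tr}(180A_1^2+20A_1^3)-\operatorname{Tr}A^2\operatorname{Tr}(1040A_1^2+280A_1^3+30A_1^4)+15\operatorname{Tr}A^2(\operatorname{Tr}A_1^2)^2-\operatorname{Tr}A_1^2\operatorname{Tr}(120A_1^2+20A_1^3)+\operatorname{Tr}(1920A_1^2+960A_1^3+240A_1^4+24A_1^5)\big]$.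 (5) If $G$ is a forest, $c_{n-6}(G)=\frac{1}{6!}\big[\prod_{i=0}^5(\operatorname{Tr}A^2-2i)-15(\operatorname{Tr}A^2)^4\operatorname{Tr}A_1^2+(\operatorname{Tr}A^2)^3\operatorname{Tr}(420A_1^2+40A_1^3)-(\operatorname{Tr}A^2)^2\operatorname{Tr}(4260A_1^2+960A_1^3+90A_1^4)+45(\operatorname{Tr}A^2\operatorname{Tr}A_1^2)^2-810\operatorname{Tr}A^2(\operatorname{Tr}A_1^2)^2+\operatorname{Tr}A^2\operatorname{Tr}(18480A_1^2+7520A_1^3+1620A_1^4+144A_1^5)-15(\operatorname{Tr}A_1^2)^3+3600(\operatorname{Tr}A_1^2)^2-28800\operatorname{Tr}A_1^2+\operatorname{Tr}A_1^2\operatorname{Tr}(1200A_1^3+90A_1^4)+40(\operatorname{Tr}A_1^3)^2-120\operatorname{Tr}A^2\operatorname{Tr}A_1^2\operatorname{Tr}A_1^3-\operatorname{Tr}(19200A_1^3-7200A_1^4-1440A_1^5-120A_1^6)\big]$.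
   Context: $L(G)$ is the Laplacian matrix (degree matrix minus adjacency matrix). The line graph $L_1(G)$ has vertex set $E(G)$, two edges being adjacent iff they share an endpoint. $\operatorname{Tr}$ denotes trace (so $\operatorname{Tr}A^k$ is the number of closed walks of length $k$ in $G$).
   Formalization: In (5) the last term is corrected to −Tr(19200A_1^3+7200A_1^4+1440A_1^5+120A_1^6); with the printed inner minus signs the formula fails, e.g. for a path on three vertices plus three isolated vertices (it gives 29280/720 instead of c_0=0). *)

theory Defs
  imports "Jordan_Normal_Form.Char_Poly"
begin

text \<open>A simple graph is a finite vertex set \<open>V\<close> with an edge set \<open>E\<close> of two-element
  subsets of \<open>V\<close>.\<close>

definition simple_graph :: "'a set \<Rightarrow> 'a set set \<Rightarrow> bool" where
  "simple_graph V E \<longleftrightarrow> finite V \<and> (\<forall>e\<in>E. e \<subseteq> V \<and> card e = 2)"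

definition graph_cycle :: "'a set set \<Rightarrow> 'a list \<Rightarrow> bool" where
  "graph_cycle E p \<longleftrightarrow> 3 \<le> length p \<and> distinct p \<and>
     (\<forall>i < length p. {p ! i, p ! (Suc i mod length p)} \<in> E)"

definition forest_graph :: "'a set \<Rightarrow> 'a set set \<Rightarrow> bool" where
  "forest_graph V E \<longleftrightarrow> simple_graph V E \<and> (\<nexists>p. graph_cycle E p)"

text \<open>The line graph of \<open>(V, E)\<close> has vertex set \<open>E\<close> and the following edge set.\<close>

definition line_graph_edges :: "'a set set \<Rightarrow> 'a set set set" where
  "line_graph_edges E = {{e, f} | e f. e \<in> E \<and> f \<in> E \<and> e \<noteq> f \<and> e \<inter> f \<noteq> {}}"

definition vertex_degree :: "'a set set \<Rightarrow> 'a \<Rightarrow> nat" where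
  "vertex_degree E v = card {e \<in> E. v \<in> e}"

text \<open>The list \<open>vs\<close> enumerates the vertices without repetition; it fixes the order of rows and
  columns.\<close>

definition adjacency_matrix :: "'a list \<Rightarrow> 'a set set \<Rightarrow> real mat" where
  "adjacency_matrix vs E =
     mat (length vs) (length vs) (\<lambda>(i, j). if {vs ! i, vs ! j} \<in> E then 1 else 0)"

definition degree_matrix :: "'a list \<Rightarrow> 'a set set \<Rightarrow> real mat" where
  "degree_matrix vs E =
     mat (length vs) (length vs) (\<lambda>(i, j). if i = j then real (vertex_degree E (vs ! i)) else 0)"

definition laplacian_matrix :: "'a list \<Rightarrow> 'a set set \<Rightarrow> real mat" where
  "laplacian_matrix vs E = degree_matrix vs E - adjacency_matrix vs E"

definition mat_trace :: "'a :: comm_monoid_add mat \<Rightarrow> 'a" where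
  "mat_trace A = (\<Sum>i < dim_row A. A $$ (i, i))"

text \<open>Erratum: in the formula for the sixth coefficient, the last term is printed in the source as
  \<open>- Tr (19200 A1^3 - 7200 A1^4 - 1440 A1^5 - 120 A1^6)\<close>. With these inner signs the identity is
  false, e.g. for the path on three vertices plus three isolated vertices, where
  \<open>Tr A^2 = 4\<close>, \<open>Tr A1^k = 2\<close> for even \<open>k\<close> and \<open>0\<close> for odd \<open>k\<close>: it gives
  \<open>29280 / 720\<close> instead of \<open>0\<close>. The correct term,
  \<open>- Tr (19200 A1^3 + 7200 A1^4 + 1440 A1^5 + 120 A1^6)\<close>, comes from Newton's identities for
  \<open>2 I + A1\<close>, which has the same nonzero eigenvalues as the Laplacian of a forest.\<close>

end

theory Submission
  imports Defs "Jordan_Normal_Form.Schur_Decomposition"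
    "HOL-Computational_Algebra.Polynomial_FPS"
begin

text \<open>
  Newton's identities express the coefficients of the characteristic polynomial of the Laplacian
  \<open>L = D - A\<close> by the traces of its powers. With \<open>B\<close> the unsigned vertex-edge incidence matrix,
  \<open>B B\<^sup>T = D + A\<close> and \<open>B\<^sup>T B = 2 I + A1\<close>, so the powers of \<open>D + A\<close> and of \<open>2 I + A1\<close> have the
  same traces, and the latter expand binomially. Passing from \<open>D + A\<close> to \<open>D - A\<close> does not change
  the traces of the first two powers and lowers that of the third by \<open>2 Tr A\<^sup>3\<close>. A forest is
  bipartite, so there \<open>D - A\<close> and \<open>D + A\<close> are conjugate by a diagonal sign matrix.
\<close>

subsection \<open>Newton's identities\<close>

text \<open>This is the logarithmic derivative of \<open>P\<close> cleared of denominators: each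
  factor \<open>1 - a X\<close> contributes \<open>- a X / (1 - a X)\<close>, a geometric series
  without constant term. Hence the coefficient of \<open>S\<close> at \<open>0\<close> is
  \<open>0\<close>.\<close>

lemma newton_fps:
  fixes as :: "'a :: idom list"
  defines "P \<equiv> \<Prod>a\<leftarrow>as. 1 - fps_const a * fps_X"
    and "S \<equiv> Abs_fps (\<lambda>k. if k = 0 then 0 else \<Sum>a\<leftarrow>as. a ^ k)"
  shows "fps_X * fps_deriv P = - (P * S)"
  unfolding assms
proof (induction as)
  case Nil
  then show ?case by (simp add: fps_eq_iff)
next
  case (Cons a as)
  let ?L = "1 - fps_const a * fps_X :: 'a fps"
  let ?P = "\<Prod>b\<leftarrow>as. 1 - fps_const b * fps_X :: 'a fps"
  let ?S = "Abs_fps (\<lambda>k. if k = 0 then 0 else \<Sum>b\<leftarrow>as. b ^ k)"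
  let ?G = "Abs_fps (\<lambda>k. if k = 0 then 0 else a ^ k)"
  have S: "Abs_fps (\<lambda>k. if k = 0 then 0 else \<Sum>b\<leftarrow>a # as. b ^ k) = ?G + ?S"
    by (simp add: fps_eq_iff)
  \<comment> \<open>The geometric series for \<open>a X / (1 - a X)\<close>, stated without
    division.\<close>
  have G: "?L * ?G = fps_const a * fps_X"
  proof (rule fps_ext)
    fix k
    show "fps_nth (?L * ?G) k = fps_nth (fps_const a * fps_X) k"
    proof (cases k)
      case (Suc j)
      then show ?thesis
        by (cases j) (simp_all add: left_diff_distrib mult.assoc)
    qed (simp add: left_diff_distrib mult.assoc)
  qed
  have "fps_X * fps_deriv (?L * ?P) = - (fps_const a * fps_X) * ?P + ?L * (fps_X * fps_deriv ?P)"
    by (simp add: algebra_simps)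
  also have "\<dots> = - (?L * ?G) * ?P - ?L * (?P * ?S)"
    unfolding Cons.IH G by simp
  also have "\<dots> = - ((?L * ?P) * (?G + ?S))"
    by (simp add: algebra_simps)
  finally show ?case
    unfolding S by simp
qed

text \<open>Reversing the coefficients of \<open>p\<close> gives the product of the factors
  \<open>1 - a X\<close>, so comparing coefficients in the power series identity yields Newton's
  identities counted from the leading coefficient down.\<close>

lemma newton_linear_factors:
  fixes as :: "'a :: idom list"
  defines "p \<equiv> \<Prod>a\<leftarrow>as. [:- a, 1:]"
  assumes "k \<le> length as"
  shows "of_nat k * coeff p (length as - k) =
    - (\<Sum>i = 1..k. coeff p (length as - (k - i)) * (\<Sum>a\<leftarrow>as. a ^ i))"
proof -
  define q where "q = (\<Prod>a\<leftarrow>as. [:1, - a:])"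
  let ?S = "Abs_fps (\<lambda>k. if k = 0 then 0 else \<Sum>a\<leftarrow>as. a ^ k)"
  \<comment> \<open>\<open>reflect_poly\<close> reverses with respect to the actual degree, so the
    degree must be known exactly.\<close>
  have "degree p = length as"
    unfolding p_def
  proof (induction as)
    case (Cons a as)
    have "(\<Prod>a\<leftarrow>as. [:- a, 1:]) \<noteq> 0"
      by (auto simp: prod_list_zero_iff)
    then show ?case
      using Cons.IH degree_mult_eq[of "[:- a, 1:]"] by (simp del: mult_pCons_left)
  qed simp
  moreover have "reflect_poly [:- a, 1:] = [:1, - a:]" for a :: 'a
    by (simp add: reflect_poly_def)
  then have "reflect_poly p = q"
    unfolding p_def q_def
    by (induction as) (simp_all add: reflect_poly_mult del: mult_pCons_left)
  ultimately have coeff: "coeff p (length as - j) = coeff q j" if "j \<le> length as" for j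
    using that by (auto simp: coeff_reflect_poly)
  have lin: "fps_of_poly [:1, - a:] = 1 - fps_const a * fps_X" for a :: 'a
    by (simp add: fps_of_poly_pCons flip: fps_const_neg)
  have fps: "fps_of_poly q = (\<Prod>a\<leftarrow>as. 1 - fps_const a * fps_X)"
    unfolding q_def fps_of_poly_prod_list map_map o_def lin ..
  \<comment> \<open>The operator \<open>X d/dX\<close> multiplies the coefficient at
    \<open>k\<close> by \<open>k\<close>.\<close>
  have "of_nat k * coeff q k = fps_nth (fps_X * fps_deriv (fps_of_poly q)) k"
    by (cases k) simp_all
  also have "\<dots> = - fps_nth (?S * fps_of_poly q) k"
    unfolding fps by (subst newton_fps) (simp add: mult.commute)
  also have "\<dots> = - (\<Sum>i = 0..k. (if i = 0 then 0 else \<Sum>a\<leftarrow>as. a ^ i) * coeff q (k - i))"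
    by (simp add: fps_mult_nth)
  also have "\<dots> = - (\<Sum>i = 1..k. coeff q (k - i) * (\<Sum>a\<leftarrow>as. a ^ i))"
    by (simp add: sum.atLeast_Suc_atMost mult.commute)
  also have "\<dots> = - (\<Sum>i = 1..k. coeff p (length as - (k - i)) * (\<Sum>a\<leftarrow>as. a ^ i))"
    using assms(2)
    by (intro arg_cong[of _ _ uminus] sum.cong) (simp_all only: coeff diff_le_self le_trans)
  finally show ?thesis
    using assms(2) by (simp add: coeff)
qed

subsection \<open>Traces of matrix powers\<close>

lemma mat_trace_add:
  "A \<in> carrier_mat n n \<Longrightarrow> B \<in> carrier_mat n n \<Longrightarrow> mat_trace (A + B) = mat_trace A + mat_trace B"
  by (auto simp: mat_trace_def sum.distrib)

lemma mat_trace_smult: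
  fixes A :: "'a :: comm_semiring_0 mat"
  shows "A \<in> carrier_mat n n \<Longrightarrow> mat_trace (c \<cdot>\<^sub>m A) = c * mat_trace A"
  by (auto simp: mat_trace_def sum_distrib_left)

text \<open>Rectangular factors are allowed because an incidence matrix need not be square.\<close>

lemma mat_trace_mult_commute:
  fixes A :: "'a :: comm_semiring_0 mat"
  assumes "A \<in> carrier_mat n m" "B \<in> carrier_mat m n"
  shows "mat_trace (A * B) = mat_trace (B * A)"
proof -
  have "mat_trace (A * B) = (\<Sum>i<n. \<Sum>j<m. A $$ (i, j) * B $$ (j, i))"
    using assms by (auto simp: mat_trace_def scalar_prod_def atLeast0LessThan intro!: sum.cong)
  also have "\<dots> = (\<Sum>j<m. \<Sum>i<n. B $$ (j, i) * A $$ (i, j))"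
    by (subst sum.swap) (simp add: mult.commute)
  also have "\<dots> = mat_trace (B * A)"
    using assms by (auto simp: mat_trace_def scalar_prod_def atLeast0LessThan intro!: sum.cong)
  finally show ?thesis .
qed

lemma mat_trace_similar:
  fixes A :: "'a :: comm_semiring_1 mat"
  assumes "similar_mat_wit A B P Q"
  shows "mat_trace A = mat_trace B"
proof -
  define n where "n = dim_row A"
  note D = similar_mat_witD[OF n_def assms]
  have "mat_trace A = mat_trace (Q * (P * B))"
    unfolding D(3) using D by (intro mat_trace_mult_commute[of _ n n]) auto
  also have "Q * (P * B) = B"
    using D by (simp add: assoc_mult_mat[symmetric, of Q n n P n B n])
  finally show ?thesis .
qed

text \<open>By \<open>shift\<close>, \<open>B\<close> slides through a power of \<open>B * C\<close>
  and turns it into a power of \<open>C * B\<close>; cyclicity of the trace does the rest. One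
  factor must be present to be moved: at \<open>k = 0\<close> the traces would be \<open>n\<close>
  and \<open>m\<close>.\<close>

lemma mat_trace_pow_mult_commute:
  fixes B :: "'a :: comm_semiring_1 mat"
  assumes B: "B \<in> carrier_mat n m" and C: "C \<in> carrier_mat m n" and "k \<noteq> 0"
  shows "mat_trace ((B * C) ^\<^sub>m k) = mat_trace ((C * B) ^\<^sub>m k)"
proof -
  have shift: "(B * C) ^\<^sub>m j * B = B * (C * B) ^\<^sub>m j" for j
  proof (induction j)
    case 0
    then show ?case using B C by simp
  next
    case (Suc j)
    have BC: "(B * C) ^\<^sub>m j \<in> carrier_mat n n" and CB: "(C * B) ^\<^sub>m j \<in> carrier_mat m m"
      using B C by (auto intro!: pow_carrier_mat)
    have "(B * C) ^\<^sub>m Suc j * B = ((B * C) ^\<^sub>m j * B) * (C * B)"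
      using B C BC by (simp add: assoc_mult_mat[of _ n n _ n _ m] assoc_mult_mat[of _ n m _ n _ m]
          assoc_mult_mat[of _ n n _ m _ m])
    also have "\<dots> = B * (C * B) ^\<^sub>m Suc j"
      unfolding Suc.IH using B C CB by (simp add: assoc_mult_mat[of _ n m _ m _ m])
    finally show ?case .
  qed
  obtain j where k: "k = Suc j" using \<open>k \<noteq> 0\<close> not0_implies_Suc by blast
  have BC: "(B * C) ^\<^sub>m j \<in> carrier_mat n n" and CB: "(C * B) ^\<^sub>m j \<in> carrier_mat m m"
    using B C by (auto intro!: pow_carrier_mat)
  have "mat_trace ((B * C) ^\<^sub>m k) = mat_trace ((B * C) ^\<^sub>m j * B * C)"
    using B C BC by (simp add: k assoc_mult_mat[of _ n n _ m _ n])
  also have "\<dots> = mat_trace (C * (B * (C * B) ^\<^sub>m j))"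
    unfolding shift using B C CB by (intro mat_trace_mult_commute[of _ n m]) auto
  also have "\<dots> = mat_trace (C * B * (C * B) ^\<^sub>m j)"
    using B C CB by (simp add: assoc_mult_mat[of _ m n _ m _ m])
  also have "\<dots> = mat_trace ((C * B) ^\<^sub>m k)"
    unfolding k pow_mat.simps using B C CB by (intro mat_trace_mult_commute[of _ m m]) auto
  finally show ?thesis .
qed

lemma upper_triangular_pow:
  fixes B :: "'a :: comm_semiring_1 mat"
  assumes B: "B \<in> carrier_mat n n" and "upper_triangular B"
  shows "upper_triangular (B ^\<^sub>m k) \<and> (\<forall>i<n. (B ^\<^sub>m k) $$ (i, i) = (B $$ (i, i)) ^ k)"
proof (induction k)
  case 0
  then show ?case using B by auto
next
  case (Suc k)
  have Bk: "B ^\<^sub>m k \<in> carrier_mat n n"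
    using B by (rule pow_carrier_mat)
  have entry: "(B ^\<^sub>m Suc k) $$ (i, j) = (\<Sum>l<n. (B ^\<^sub>m k) $$ (i, l) * B $$ (l, j))"
    if "i < n" "j < n" for i j
    using B Bk that by (auto simp: scalar_prod_def atLeast0LessThan)
  \<comment> \<open>A nonzero summand needs \<open>i \<le> l \<le> j\<close>. Below the diagonal no
    such \<open>l\<close> exists, and on the diagonal only \<open>l = i\<close> is left.\<close>
  have zero: "(B ^\<^sub>m k) $$ (i, l) * B $$ (l, j) = 0" if "i < n" "l < n" "l < i \<or> j < l" for i j l
    using that Suc.IH assms(2) B Bk by (auto simp: upper_triangular_def)
  have "(B ^\<^sub>m Suc k) $$ (i, j) = 0" if "i < n" "j < i" for i j
    unfolding entry[OF that(1) order.strict_trans[OF that(2,1)]]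
    using that by (intro sum.neutral ballI zero) auto
  moreover have "(B ^\<^sub>m Suc k) $$ (i, i) = (B $$ (i, i)) ^ Suc k" if "i < n" for i
  proof -
    have "(B ^\<^sub>m Suc k) $$ (i, i) = (\<Sum>l\<in>{i}. (B ^\<^sub>m k) $$ (i, l) * B $$ (l, i))"
      unfolding entry[OF that that]
      by (rule sum.mono_neutral_right) (use that in \<open>auto intro!: zero\<close>)
    then show ?thesis using Suc.IH that by (simp add: mult.commute)
  qed
  ultimately show ?case
    using B by (auto simp: upper_triangular_def)
qed

text \<open>Schur decomposition makes \<open>A\<close> similar to a triangular matrix with diagonal
  \<open>as\<close>. The same similarity relates the powers, and powers of a triangular matrix have
  the powers of its diagonal entries on the diagonal.\<close>

lemma mat_trace_pow_eigenvalues: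
  fixes A :: "complex mat"
  assumes A: "A \<in> carrier_mat n n" and cp: "char_poly A = (\<Prod>a\<leftarrow>as. [:- a, 1:])"
  shows "mat_trace (A ^\<^sub>m k) = (\<Sum>a\<leftarrow>as. a ^ k)"
proof -
  obtain B P Q where sim: "similar_mat_wit A B P Q" and tri: "upper_triangular B"
    and diag: "diag_mat B = as"
    using schur_decomposition[OF A cp] by (metis prod_cases3)
  have B: "B \<in> carrier_mat n n"
    using similar_mat_witD2[OF A sim] by blast
  have "mat_trace (A ^\<^sub>m k) = mat_trace (B ^\<^sub>m k)"
    by (rule mat_trace_similar[OF similar_mat_wit_pow[OF sim]])
  also have "\<dots> = (\<Sum>i<n. (B $$ (i, i)) ^ k)"
    using upper_triangular_pow[OF B tri, of k] B by (simp add: mat_trace_def)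
  also have "\<dots> = (\<Sum>a\<leftarrow>as. a ^ k)"
    using B by (simp add: diag[symmetric] diag_mat_def o_def interv_sum_list_conv_sum_set_nat
        atLeast0LessThan)
  finally show ?thesis .
qed

text \<open>The characteristic polynomial splits over the complex numbers, where the eigenvalue
  version applies. Coefficients and traces are images of real numbers, so injectivity of the
  embedding brings the identity back.\<close>

lemma newton_char_poly:
  fixes A :: "real mat"
  assumes A: "A \<in> carrier_mat n n" and "k \<le> n"
  shows "real k * coeff (char_poly A) (n - k) =
    - (\<Sum>i = 1..k. coeff (char_poly A) (n - (k - i)) * mat_trace (A ^\<^sub>m i))"
proof -
  let ?A = "map_mat complex_of_real A"
  have A': "?A \<in> carrier_mat n n" using A by simp
  obtain as where as: "char_poly ?A = (\<Prod>a\<leftarrow>as. [:- a, 1:])" "length as = n"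
    using char_poly_factorized[OF A'] by blast
  have coeff: "coeff (char_poly ?A) j = complex_of_real (coeff (char_poly A) j)" for j
    by (simp add: of_real_hom.char_poly_hom[OF A])
  have trace: "(\<Sum>a\<leftarrow>as. a ^ j) = complex_of_real (mat_trace (A ^\<^sub>m j))" for j
    using A pow_carrier_mat[OF A, of j]
    by (simp add: mat_trace_pow_eigenvalues[OF A' as(1), symmetric]
        of_real_hom.mat_hom_pow[OF A, symmetric] mat_trace_def)
  have "complex_of_real (real k * coeff (char_poly A) (n - k)) =
    complex_of_real (- (\<Sum>i = 1..k. coeff (char_poly A) (n - (k - i)) * mat_trace (A ^\<^sub>m i)))"
    using newton_linear_factors[of k as] \<open>k \<le> n\<close>
    by (simp add: as(1)[symmetric] as(2) coeff trace)
  then show ?thesis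
    unfolding of_real_eq_iff .
qed

section \<open>Binomial expansion of traces of powers of a shifted matrix\<close>

lemma pow_mat_Suc_left:
  fixes A :: "'a :: semiring_1 mat"
  assumes A: "A \<in> carrier_mat n n"
  shows "A * A ^\<^sub>m k = A ^\<^sub>m Suc k"
proof (induction k)
  case 0
  then show ?case using A by simp
next
  case (Suc k)
  have "A * A ^\<^sub>m Suc k = A * A ^\<^sub>m k * A"
    using A pow_carrier_mat[OF A, of k] by (simp add: assoc_mult_mat[of _ n n _ n _ n])
  then show ?case
    unfolding Suc.IH by simp
qed

text \<open>One factor \<open>M\<close> is expanded as \<open>c I + A\<close>. The power
  \<open>A ^ j\<close> collects the copies of \<open>A\<close> split off so far, so the traces obey
  a Pascal recurrence in \<open>k\<close> and \<open>j\<close>.\<close>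

lemma mat_trace_shift_pow_mult:
  fixes A :: "'a :: comm_ring_1 mat" and c :: 'a
  assumes A: "A \<in> carrier_mat n n"
  defines "M \<equiv> c \<cdot>\<^sub>m 1\<^sub>m n + A"
  shows "mat_trace (M ^\<^sub>m Suc k * A ^\<^sub>m j) =
    c * mat_trace (M ^\<^sub>m k * A ^\<^sub>m j) + mat_trace (M ^\<^sub>m k * A ^\<^sub>m Suc j)"
proof -
  have M: "M \<in> carrier_mat n n"
    using A by (simp add: M_def)
  note carriers = A M pow_carrier_mat[OF A] pow_carrier_mat[OF M]
  have "M * A ^\<^sub>m j = (c \<cdot>\<^sub>m 1\<^sub>m n) * A ^\<^sub>m j + A * A ^\<^sub>m j"
    unfolding M_def using carriers by (intro add_mult_distrib_mat[of _ n n _ _ n]) auto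
  also have "(c \<cdot>\<^sub>m 1\<^sub>m n) * A ^\<^sub>m j = c \<cdot>\<^sub>m A ^\<^sub>m j"
    using carriers by (simp add: mult_smult_assoc_mat[of _ n n _ n])
  also have "A * A ^\<^sub>m j = A ^\<^sub>m Suc j"
    by (rule pow_mat_Suc_left[OF A])
  finally have MA: "M * A ^\<^sub>m j = c \<cdot>\<^sub>m A ^\<^sub>m j + A ^\<^sub>m Suc j" .
  have "M ^\<^sub>m Suc k * A ^\<^sub>m j = M ^\<^sub>m k * (c \<cdot>\<^sub>m A ^\<^sub>m j + A ^\<^sub>m Suc j)"
    unfolding MA[symmetric] using carriers by (simp add: assoc_mult_mat[of _ n n _ n _ n])
  also have "\<dots> = M ^\<^sub>m k * (c \<cdot>\<^sub>m A ^\<^sub>m j) + M ^\<^sub>m k * A ^\<^sub>m Suc j"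
    using carriers(3,4) by (intro mult_add_distrib_mat[of _ n n _ n]) (simp_all del: pow_mat.simps)
  also have "M ^\<^sub>m k * (c \<cdot>\<^sub>m A ^\<^sub>m j) = c \<cdot>\<^sub>m (M ^\<^sub>m k * A ^\<^sub>m j)"
    using carriers by (simp add: mult_smult_distrib[of _ n n _ n])
  finally show ?thesis
    using mult_carrier_mat[OF carriers(4) carriers(3)]
    by (simp only: mat_trace_add[where n = n] mat_trace_smult[where n = n] smult_carrier_mat)
qed

text \<open>Pascal's rule for an arbitrary sequence \<open>f\<close> in place of powers;
  \<open>f\<close> will be a sequence of traces.\<close>

lemma binomial_sum_Suc:
  fixes f :: "nat \<Rightarrow> 'a :: comm_semiring_1"
  shows "(\<Sum>i\<le>Suc k. of_nat (Suc k choose i) * c ^ (Suc k - i) * f i) =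
    c * (\<Sum>i\<le>k. of_nat (k choose i) * c ^ (k - i) * f i)
      + (\<Sum>i\<le>k. of_nat (k choose i) * c ^ (k - i) * f (Suc i))"
proof -
  have "c * (\<Sum>i\<le>k. of_nat (k choose i) * c ^ (k - i) * f i) =
      (\<Sum>i\<le>k. of_nat (k choose i) * c ^ (Suc k - i) * f i)"
    unfolding sum_distrib_left by (intro sum.cong) (simp_all add: Suc_diff_le mult_ac)
  \<comment> \<open>The added summand \<open>i = Suc k\<close> vanishes because
    \<open>k choose Suc k\<close> is \<open>0\<close>.\<close>
  also have "\<dots> = (\<Sum>i\<le>Suc k. of_nat (k choose i) * c ^ (Suc k - i) * f i)"
    by (simp add: binomial_eq_0)
  also have "\<dots> = c ^ Suc k * f 0 + (\<Sum>i\<le>k. of_nat (k choose Suc i) * c ^ (k - i) * f (Suc i))"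
    by (subst sum.atMost_Suc_shift) simp
  finally have shift: "c * (\<Sum>i\<le>k. of_nat (k choose i) * c ^ (k - i) * f i) =
      c ^ Suc k * f 0 + (\<Sum>i\<le>k. of_nat (k choose Suc i) * c ^ (k - i) * f (Suc i))" .
  show ?thesis
    unfolding shift
    by (subst sum.atMost_Suc_shift) (simp add: sum.distrib distrib_right add_ac)
qed

lemma mat_trace_binomial:
  fixes A :: "'a :: comm_ring_1 mat" and c :: 'a
  assumes A: "A \<in> carrier_mat n n"
  shows "mat_trace ((c \<cdot>\<^sub>m 1\<^sub>m n + A) ^\<^sub>m k) =
    (\<Sum>i\<le>k. of_nat (k choose i) * c ^ (k - i) * mat_trace (A ^\<^sub>m i))"
proof -
  let ?M = "c \<cdot>\<^sub>m 1\<^sub>m n + A"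
  have M: "?M \<in> carrier_mat n n" using A by simp
  \<comment> \<open>The exponent \<open>j\<close> is generalised because the recurrence calls for
    both \<open>j\<close> and \<open>Suc j\<close>; the lemma is the case
    \<open>j = 0\<close>.\<close>
  have "mat_trace (?M ^\<^sub>m k * A ^\<^sub>m j) =
      (\<Sum>i\<le>k. of_nat (k choose i) * c ^ (k - i) * mat_trace (A ^\<^sub>m (j + i)))" for j
  proof (induction k arbitrary: j)
    case 0
    have "dim_row A = n" using A by simp
    then show ?case using A by simp
  next
    case (Suc k)
    show ?case
      unfolding mat_trace_shift_pow_mult[OF A] Suc.IH binomial_sum_Suc by simp
  qed
  from this[of 0] show ?thesis
    using A pow_carrier_mat[OF M, of k] by simp
qed

lemma mat_trace_pow2:
  fixes A :: "'a :: comm_semiring_1 mat"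
  assumes "A \<in> carrier_mat n n"
  shows "mat_trace (A ^\<^sub>m 2) = (\<Sum>i<n. \<Sum>j<n. A $$ (i, j) * A $$ (j, i))"
  using assms
  by (auto simp: numeral_2_eq_2 mat_trace_def scalar_prod_def atLeast0LessThan intro!: sum.cong)

lemma mat_trace_pow3:
  fixes A :: "'a :: comm_semiring_1 mat"
  assumes "A \<in> carrier_mat n n"
  shows "mat_trace (A ^\<^sub>m 3) = (\<Sum>i<n. \<Sum>j<n. \<Sum>k<n. A $$ (i, j) * A $$ (j, k) * A $$ (k, i))"
  using assms
  by (auto simp: numeral_3_eq_3 mat_trace_def scalar_prod_def atLeast0LessThan sum_distrib_left
      mult.assoc       intro!: sum.cong)

subsection \<open>Two-colourability of acyclic graphs\<close>

text \<open>A walk is extended step by step; if the new end point already lies on the path, the path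
  is cut off there, which keeps it distinct.\<close>

lemma rtranclp_imp_distinct_path:
  assumes "R\<^sup>*\<^sup>* u v"
  shows "\<exists>p. p \<noteq> [] \<and> distinct p \<and> hd p = u \<and> last p = v \<and> successively R p"
  using assms
proof (induction rule: rtranclp_induct)
  case base
  show ?case by (rule exI[of _ "[u]"]) simp
next
  case (step y z)
  then obtain p where p: "p \<noteq> []" "distinct p" "hd p = u" "last p = y" "successively R p"
    by blast
  show ?case
  proof (cases "z \<in> set p")
    case True
    then obtain xs ys where "p = xs @ z # ys" by (meson split_list)
    with p show ?thesis
      by (intro exI[of _ "xs @ [z]"]) (auto simp: successively_append_iff hd_append)
  next
    case False
    with p step.hyps show ?thesis
      by (intro exI[of _ "p @ [z]"]) (auto simp: successively_append_iff)
  qed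
qed

text \<open>Edges are added one at a time. In an acyclic graph a new edge joins two different
  components, and the colours of one of them can be exchanged freely.\<close>

lemma acyclic_imp_two_colouring:
  assumes "finite E" "\<forall>e\<in>E. card e = 2" "\<nexists>p. graph_cycle E p"
  shows "\<exists>f :: 'a \<Rightarrow> bool. \<forall>x y. {x, y} \<in> E \<longrightarrow> f x \<noteq> f y"
  using assms
proof (induction rule: finite_induct)
  case empty
  then show ?case by simp
next
  case (insert e F)
  have "\<nexists>p. graph_cycle F p"
    using insert.prems(2) by (auto simp: graph_cycle_def)
  then obtain f :: "'a \<Rightarrow> bool" where f: "f x \<noteq> f y" if "{x, y} \<in> F" for x y
    using insert.IH insert.prems(1) by blast
  obtain u v where e: "e = {u, v}" and "u \<noteq> v"
    using insert.prems(1) by (meson card_2_iff insertI1)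
  define R where "R = (\<lambda>x y. {x, y} \<in> F)"
  \<comment> \<open>Otherwise a path from \<open>u\<close> to \<open>v\<close> in \<open>F\<close>,
    closed up by \<open>e\<close>, would be a cycle.\<close>
  have "\<not> R\<^sup>*\<^sup>* u v"
  proof
    assume "R\<^sup>*\<^sup>* u v"
    from rtranclp_imp_distinct_path[OF this] obtain p where p: "p \<noteq> []" "distinct p" "hd p = u" "last p = v" "successively R p"
      by blast
    obtain x xs where x: "p = x # xs"
      using p(1) by (cases p) auto
    obtain y ys where y: "xs = y # ys"
      using p(3,4) \<open>u \<noteq> v\<close> x by (cases xs) auto
    \<comment> \<open>A path with only two vertices would be the edge \<open>e\<close> itself, which
      is not in \<open>F\<close>. This gives the length \<open>3\<close> that a cycle
      requires.\<close>
    have "ys \<noteq> []"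
      using p(3-5) insert.hyps(2) by (auto simp: x y R_def e)
    then have len: "3 \<le> length p"
      by (cases ys) (auto simp: x y)
    have "{p ! i, p ! (Suc i mod length p)} \<in> insert e F" if "i < length p" for i
    proof (cases "Suc i < length p")
      case True
      then show ?thesis
        using p(5) by (auto simp: successively_conv_nth R_def)
    next
      case False
      then have "Suc i = length p" using that by simp
      \<comment> \<open>The last index wraps around to \<open>0\<close>, so the closing edge is
        \<open>e\<close>.\<close>
      then have "p ! i = v" "p ! (Suc i mod length p) = u"
        using p(1,3,4) by (auto simp: hd_conv_nth last_conv_nth simp flip: \<open>Suc i = length p\<close>)
      then show ?thesis by (simp add: e insert_commute)
    qed
    with len p(2) insert.prems(2) show False
      unfolding graph_cycle_def by blast
  qed
  \<comment> \<open>If \<open>e\<close> would be monochromatic, the colours are exchanged on the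
    component of \<open>u\<close> in \<open>F\<close>, which does not contain
    \<open>v\<close>.\<close>
  define g where "g x = (if f u = f v \<and> R\<^sup>*\<^sup>* u x then \<not> f x else f x)" for x
  \<comment> \<open>An edge of \<open>F\<close> has both ends in the component of \<open>u\<close>
    or neither, so the exchange keeps its ends differently coloured.\<close>
  have R_iff: "R\<^sup>*\<^sup>* u x \<longleftrightarrow> R\<^sup>*\<^sup>* u y" if "{x, y} \<in> F" for x y
  proof -
    have "R x y" using that by (simp add: R_def)
    moreover have "R y x" using that by (simp add: R_def insert_commute)
    ultimately show ?thesis by (blast intro: rtranclp.rtrancl_into_rtrancl)
  qed
  have "g u \<noteq> g v"
    using \<open>\<not> R\<^sup>*\<^sup>* u v\<close> by (auto simp: g_def)
  then have "g x \<noteq> g y" if "{x, y} \<in> insert e F" for x y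
    using that f[of x y] R_iff[of x y] by (auto simp: g_def e doubleton_eq_iff)
  then show ?case by blast
qed

subsection \<open>Incidence, adjacency and Laplacian matrices\<close>

text \<open>Orientation signs are left out so that the Gram matrix of the columns involves the plain
  adjacency matrix of the line graph, not a signed version of it.\<close>

definition incidence_matrix :: "'a list \<Rightarrow> 'a set list \<Rightarrow> real mat" where
  "incidence_matrix vs es =
     mat (length vs) (length es) (\<lambda>(i, j). if vs ! i \<in> es ! j then 1 else 0)"

lemma adjacency_matrix_carrier: "adjacency_matrix vs E \<in> carrier_mat (length vs) (length vs)"
  by (simp add: adjacency_matrix_def)

lemma degree_matrix_carrier: "degree_matrix vs E \<in> carrier_mat (length vs) (length vs)"
  by (simp add: degree_matrix_def)

lemma laplacian_matrix_carrier: "laplacian_matrix vs E \<in> carrier_mat (length vs) (length vs)"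
  unfolding laplacian_matrix_def by (intro minus_carrier_mat adjacency_matrix_carrier)

lemma incidence_matrix_carrier: "incidence_matrix vs es \<in> carrier_mat (length vs) (length es)"
  by (simp add: incidence_matrix_def)

lemma sum_nth_indicator:
  assumes "distinct xs"
  shows "(\<Sum>i<length xs. if P (xs ! i) then 1 else 0 :: real) = real (card {x \<in> set xs. P x})"
proof -
  have "(\<Sum>i<length xs. if P (xs ! i) then 1 else 0 :: real) = (\<Sum>x\<in>set xs. if P x then 1 else 0)"
    using assms by (intro sum.reindex_bij_betw bij_betw_nth) auto
  also have "\<dots> = real (card {x \<in> set xs. P x})"
    by (simp flip: sum.inter_filter)
  finally show ?thesis .
qed

locale enumerated_graph =
  fixes V :: "'a set" and E :: "'a set set" and vs :: "'a list" and es :: "'a set list"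
  assumes simple: "simple_graph V E"
    and vs: "distinct vs" "set vs = V"
    and es: "distinct es" "set es = E"
begin

abbreviation "A \<equiv> adjacency_matrix vs E"
abbreviation "A1 \<equiv> adjacency_matrix es (line_graph_edges E)"
abbreviation "D \<equiv> degree_matrix vs E"
abbreviation "L \<equiv> laplacian_matrix vs E"
abbreviation "B \<equiv> incidence_matrix vs es"

lemma card_edge: "e \<in> E \<Longrightarrow> card e = 2" and edge_subset: "e \<in> E \<Longrightarrow> e \<subseteq> V"
  using simple by (auto simp: simple_graph_def)

lemma no_loop: "{x} \<notin> E"
  using card_edge[of "{x}"] by auto

lemma edge_eq: "e \<in> E \<Longrightarrow> x \<in> e \<Longrightarrow> y \<in> e \<Longrightarrow> x \<noteq> y \<Longrightarrow> e = {x, y}"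
  using card_edge[of e] by (auto simp: card_2_iff)

text \<open>Entry \<open>(i, j)\<close> counts the edges containing both vertices: the degree if
  \<open>i = j\<close>, and otherwise at most the one edge joining them.\<close>

lemma incidence_mult_transpose: "B * transpose_mat B = D + A"
proof (rule eq_matI)
  fix i j assume "i < dim_row (D + A)" "j < dim_col (D + A)"
  then have ij: "i < length vs" "j < length vs"
    by (simp_all add: adjacency_matrix_def)
  have "(B * transpose_mat B) $$ (i, j) =
      (\<Sum>k<length es. if vs ! i \<in> es ! k \<and> vs ! j \<in> es ! k then 1 else 0)"
    using ij by (auto simp: incidence_matrix_def scalar_prod_def atLeast0LessThan intro!: sum.cong)
  also have "\<dots> = real (card {e \<in> E. vs ! i \<in> e \<and> vs ! j \<in> e})"
    using sum_nth_indicator[OF es(1), of "\<lambda>e. vs ! i \<in> e \<and> vs ! j \<in> e"] by (simp add: es(2))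
  also have "\<dots> = (D + A) $$ (i, j)"
  proof (cases "i = j")
    case True
    then show ?thesis
      using ij no_loop by (simp add: degree_matrix_def adjacency_matrix_def vertex_degree_def)
  next
    case False
    then have "vs ! i \<noteq> vs ! j"
      using ij vs(1) by (simp add: nth_eq_iff_index_eq)
    then have "e = {vs ! i, vs ! j}" if "e \<in> E" "vs ! i \<in> e" "vs ! j \<in> e" for e
      using edge_eq that by blast
    then have "e \<in> E \<and> vs ! i \<in> e \<and> vs ! j \<in> e \<longleftrightarrow> e = {vs ! i, vs ! j} \<and> {vs ! i, vs ! j} \<in> E"
      for e
      by (metis insertI1 insert_commute)
    then show ?thesis
      using ij False by (simp add: degree_matrix_def adjacency_matrix_def)
  qed
  finally show "(B * transpose_mat B) $$ (i, j) = (D + A) $$ (i, j)" .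
qed (auto simp: incidence_matrix_def adjacency_matrix_def)

text \<open>Entry \<open>(i, j)\<close> counts the common end points of two edges: two if
  \<open>i = j\<close>, and at most one otherwise, since edges sharing two vertices
  coincide.\<close>

lemma incidence_transpose_mult: "transpose_mat B * B = 2 \<cdot>\<^sub>m 1\<^sub>m (length es) + A1"
proof (rule eq_matI)
  fix i j assume "i < dim_row (2 \<cdot>\<^sub>m 1\<^sub>m (length es) + A1)" "j < dim_col (2 \<cdot>\<^sub>m 1\<^sub>m (length es) + A1)"
  then have ij: "i < length es" "j < length es"
    by (simp_all add: adjacency_matrix_def)
  then have edges: "es ! i \<in> E" "es ! j \<in> E"
    using es(2) by auto
  have "(transpose_mat B * B) $$ (i, j) =
      (\<Sum>k<length vs. if vs ! k \<in> es ! i \<inter> es ! j then 1 else 0)"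
    using ij by (auto simp: incidence_matrix_def scalar_prod_def atLeast0LessThan intro!: sum.cong)
  also have "\<dots> = real (card {v \<in> V. v \<in> es ! i \<inter> es ! j})"
    using sum_nth_indicator[OF vs(1), of "\<lambda>v. v \<in> es ! i \<inter> es ! j"] by (simp add: vs(2))
  also have "{v \<in> V. v \<in> es ! i \<inter> es ! j} = es ! i \<inter> es ! j"
    using edge_subset[OF edges(1)] by auto
  also have "real (card (es ! i \<inter> es ! j)) = (2 \<cdot>\<^sub>m 1\<^sub>m (length es) + A1) $$ (i, j)"
  proof (cases "i = j")
    case True
    then show ?thesis
      using ij edges card_edge
      by (auto simp: adjacency_matrix_def line_graph_edges_def singleton_insert_inj_eq')
  next
    case False
    then have ne: "es ! i \<noteq> es ! j"
      using ij es(1) by (simp add: nth_eq_iff_index_eq)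
    have "card (es ! i \<inter> es ! j) = (if es ! i \<inter> es ! j = {} then 0 else 1)"
    proof (cases "es ! i \<inter> es ! j = {}")
      case False
      then obtain x where x: "x \<in> es ! i \<inter> es ! j" by blast
      moreover have "y = x" if "y \<in> es ! i \<inter> es ! j" for y
        using ne that x edge_eq[OF edges(1), of x y] edge_eq[OF edges(2), of x y] by auto
      ultimately have "es ! i \<inter> es ! j = {x}" by blast
      then show ?thesis by simp
    qed simp
    moreover have "{es ! i, es ! j} \<in> line_graph_edges E \<longleftrightarrow> es ! i \<inter> es ! j \<noteq> {}"
      using ne edges by (auto simp: line_graph_edges_def doubleton_eq_iff Int_commute)
    ultimately show ?thesis
      using ij False by (simp add: adjacency_matrix_def)
  qed
  finally show "(transpose_mat B * B) $$ (i, j) = (2 \<cdot>\<^sub>m 1\<^sub>m (length es) + A1) $$ (i, j)" .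
qed (auto simp: incidence_matrix_def adjacency_matrix_def)

section \<open>Traces of the degree, adjacency and line graph matrices\<close>

lemma mat_trace_signless_laplacian_pow:
  assumes "k \<noteq> 0"
  shows "mat_trace ((D + A) ^\<^sub>m k) = mat_trace ((2 \<cdot>\<^sub>m 1\<^sub>m (length es) + A1) ^\<^sub>m k)"
  using mat_trace_pow_mult_commute[OF incidence_matrix_carrier[of vs es] _ assms,
      of "transpose_mat B"] incidence_matrix_carrier[of vs es]
  by (simp add: incidence_mult_transpose incidence_transpose_mult)

lemma mat_trace_adjacency: "mat_trace A = 0"
  using no_loop by (simp add: mat_trace_def adjacency_matrix_def)

lemma mat_trace_line_adjacency: "mat_trace A1 = 0"
  by (auto simp: mat_trace_def adjacency_matrix_def line_graph_edges_def singleton_insert_inj_eq')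

lemma mat_trace_line_signless:
  "mat_trace (2 \<cdot>\<^sub>m 1\<^sub>m (length es) + A1) = 2 * real (length es)"
  using mat_trace_line_adjacency adjacency_matrix_carrier[of es]
  by (simp add: mat_trace_add[of _ "length es"] mat_trace_smult[of _ "length es"])
    (simp add: mat_trace_def)

text \<open>The handshake lemma, read off from the case \<open>k = 1\<close> of the trace identity,
  since \<open>A\<close> and \<open>A1\<close> have trace \<open>0\<close>.\<close>

lemma mat_trace_degree: "mat_trace D = 2 * real (length es)"
proof -
  have "mat_trace D = mat_trace ((D + A) ^\<^sub>m 1)"
    using degree_matrix_carrier adjacency_matrix_carrier[of vs E]
    by (simp add: mat_trace_add[OF degree_matrix_carrier adjacency_matrix_carrier]
        mat_trace_adjacency)
  also have "\<dots> = 2 * real (length es)"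
    using adjacency_matrix_carrier[of es "line_graph_edges E"]
    by (subst mat_trace_signless_laplacian_pow) (simp_all add: mat_trace_line_signless)
  finally show ?thesis .
qed

text \<open>An edge at \<open>v\<close> corresponds to its other end point.\<close>

lemma card_neighbours: "card {w \<in> V. {v, w} \<in> E} = vertex_degree E v"
proof -
  have "{v, w} = {v, w'} \<longleftrightarrow> w = w'" for w w'
    by (auto simp: doubleton_eq_iff)
  then have "bij_betw (\<lambda>w. {v, w}) {w \<in> V. {v, w} \<in> E} {e \<in> E. v \<in> e}"
  proof (intro bij_betw_imageI)
    show "(\<lambda>w. {v, w}) ` {w \<in> V. {v, w} \<in> E} = {e \<in> E. v \<in> e}"
    proof (intro equalityI subsetI)
      fix e assume e: "e \<in> {e \<in> E. v \<in> e}"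
      then obtain w where "w \<in> e" "w \<noteq> v"
        using card_edge[of e] by (auto simp: card_2_iff)
      with e edge_eq[of e v w] edge_subset[of e] show "e \<in> (\<lambda>w. {v, w}) ` {w \<in> V. {v, w} \<in> E}"
        by (auto intro!: image_eqI[of _ _ w])
    qed auto
  qed (auto simp: inj_on_def)
  then show ?thesis
    unfolding vertex_degree_def by (rule bij_betw_same_card)
qed

text \<open>Closed walks of length two are ordered pairs of adjacent vertices, so their number is
  the sum of the degrees.\<close>

lemma mat_trace_adjacency_pow2: "mat_trace (A ^\<^sub>m 2) = 2 * real (length es)"
proof -
  have "mat_trace (A ^\<^sub>m 2) =
      (\<Sum>i<length vs. \<Sum>j<length vs. if {vs ! i, vs ! j} \<in> E then 1 else 0)"
    unfolding mat_trace_pow2[OF adjacency_matrix_carrier]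
    by (intro sum.cong) (auto simp: adjacency_matrix_def insert_commute)
  also have "\<dots> = (\<Sum>i<length vs. real (vertex_degree E (vs ! i)))"
    using sum_nth_indicator[OF vs(1), of "\<lambda>w. {_, w} \<in> E"] by (simp add: vs(2) card_neighbours)
  also have "\<dots> = mat_trace D"
    by (simp add: mat_trace_def degree_matrix_def)
  finally show ?thesis
    by (simp add: mat_trace_degree)
qed

section \<open>Comparison of \<open>D - A\<close> with \<open>D + A\<close>\<close>

lemma adjacency_matrix_diag: "i < length vs \<Longrightarrow> A $$ (i, i) = 0"
  using no_loop by (simp add: adjacency_matrix_def)

lemma laplacian_matrix_entry:
  assumes "i < length vs" "j < length vs"
  shows "L $$ (i, j) = (if i = j then (D + A) $$ (i, j) else - (D + A) $$ (i, j))"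
  using assms no_loop by (simp add: laplacian_matrix_def degree_matrix_def adjacency_matrix_def)

lemma signless_laplacian_matrix_entry:
  assumes "i < length vs" "j < length vs" "i \<noteq> j"
  shows "(D + A) $$ (i, j) = A $$ (i, j)"
  using assms by (simp add: degree_matrix_def adjacency_matrix_def)

lemma signless_laplacian_matrix_carrier: "D + A \<in> carrier_mat (length vs) (length vs)"
  using adjacency_matrix_carrier by (rule add_carrier_mat)

lemma mat_trace_laplacian: "mat_trace L = mat_trace (D + A)"
  using laplacian_matrix_carrier[of vs E] signless_laplacian_matrix_carrier
  by (simp add: mat_trace_def laplacian_matrix_entry del: index_add_mat)

text \<open>Off-diagonal entries occur in the products \<open>L $$ (i, j) * L $$ (j, i)\<close> only
  in pairs, so their signs cancel.\<close>

lemma mat_trace_laplacian_pow2: "mat_trace (L ^\<^sub>m 2) = mat_trace ((D + A) ^\<^sub>m 2)"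
  unfolding mat_trace_pow2[OF laplacian_matrix_carrier]
    mat_trace_pow2[OF signless_laplacian_matrix_carrier]
  by (intro sum.cong) (simp_all add: laplacian_matrix_entry del: index_add_mat)

lemma mat_trace_laplacian_pow3:
  "mat_trace (L ^\<^sub>m 3) = mat_trace ((D + A) ^\<^sub>m 3) - 2 * mat_trace (A ^\<^sub>m 3)"
proof -
  have "L $$ (i, j) * L $$ (j, k) * L $$ (k, i) =
      (D + A) $$ (i, j) * (D + A) $$ (j, k) * (D + A) $$ (k, i)
        - 2 * (A $$ (i, j) * A $$ (j, k) * A $$ (k, i))"
    if "i < length vs" "j < length vs" "k < length vs" for i j k
  \<comment> \<open>If two of the indices coincide, none or two of the three factors are
    off-diagonal and the signs cancel. If all are distinct, the product changes sign, which accounts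
    for the factor \<open>2\<close>.\<close>
  proof (cases "i = j \<or> j = k \<or> k = i")
    case True
    then have "A $$ (i, j) * A $$ (j, k) * A $$ (k, i) = 0"
      using that adjacency_matrix_diag by auto
    moreover have "L $$ (i, j) * L $$ (j, k) * L $$ (k, i) =
        (D + A) $$ (i, j) * (D + A) $$ (j, k) * (D + A) $$ (k, i)"
      unfolding laplacian_matrix_entry[OF that(1,2)] laplacian_matrix_entry[OF that(2,3)]
        laplacian_matrix_entry[OF that(3,1)]
      using True by (auto simp del: index_add_mat)
    ultimately show ?thesis by simp
  next
    case False
    then show ?thesis
      using that signless_laplacian_matrix_entry[of i j] signless_laplacian_matrix_entry[of j k]
        signless_laplacian_matrix_entry[of k i]
      unfolding laplacian_matrix_entry[OF that(1,2)] laplacian_matrix_entry[OF that(2,3)]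
        laplacian_matrix_entry[OF that(3,1)]
      by (auto simp del: index_add_mat)
  qed
  then show ?thesis
    unfolding mat_trace_pow3[OF laplacian_matrix_carrier]
      mat_trace_pow3[OF adjacency_matrix_carrier]
      mat_trace_pow3[OF signless_laplacian_matrix_carrier]
      sum_distrib_left sum_subtractf[symmetric]
    by (intro sum.cong) simp_all
qed

text \<open>Conjugate matrices have conjugate powers, so a single sign matrix built from a
  two-colouring serves all exponents.\<close>

lemma forest_mat_trace_laplacian_pow:
  assumes "forest_graph V E"
  shows "mat_trace (L ^\<^sub>m k) = mat_trace ((D + A) ^\<^sub>m k)"
proof -
  have "finite E" using es(2) by auto
  then obtain f :: "'a \<Rightarrow> bool" where f: "{x, y} \<in> E \<Longrightarrow> f x \<noteq> f y" for x y
    using acyclic_imp_two_colouring[of E] card_edge assms by (auto simp: forest_graph_def)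
  let ?n = "length vs"
  define s :: "'a \<Rightarrow> real" where "s x = (if f x then 1 else -1)" for x
  have s: "s x * s x = 1" for x
    by (simp add: s_def)
  define S where "S = mat ?n ?n (\<lambda>(i, j). if i = j then s (vs ! i) else 0)"
  have S: "S \<in> carrier_mat ?n ?n" by (simp add: S_def)
  have SM: "(S * M) $$ (i, j) = s (vs ! i) * M $$ (i, j)"
    and MS: "(M * S) $$ (i, j) = M $$ (i, j) * s (vs ! j)"
    if "M \<in> carrier_mat ?n ?n" "i < ?n" "j < ?n" for M i j
    using that by (auto simp: S_def scalar_prod_def if_distrib if_distribR cong: if_cong)
  \<comment> \<open>The signs square to \<open>1\<close>, so \<open>S\<close> is its own inverse and
    can play both roles in the similarity.\<close>
  have SS: "S * S = 1\<^sub>m ?n"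
  proof (rule eq_matI)
    fix i j assume "i < dim_row (1\<^sub>m ?n :: real mat)" "j < dim_col (1\<^sub>m ?n :: real mat)"
    then show "(S * S) $$ (i, j) = 1\<^sub>m ?n $$ (i, j)"
      using SM[OF S, of i j] by (auto simp: S_def s simp del: index_mult_mat)
  qed (use S in simp_all)
  note Q = signless_laplacian_matrix_carrier
  have "L = S * (D + A) * S"
  proof (rule eq_matI)
    fix i j assume "i < dim_row (S * (D + A) * S)" "j < dim_col (S * (D + A) * S)"
    then have ij: "i < ?n" "j < ?n" using S by simp_all
    have "(S * (D + A) * S) $$ (i, j) = s (vs ! i) * (D + A) $$ (i, j) * s (vs ! j)"
      using ij by (simp only: MS[OF mult_carrier_mat[OF S Q]] SM[OF Q])
    also have "\<dots> = L $$ (i, j)"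
    proof (cases "i = j")
      case False
      \<comment> \<open>Adjacent vertices carry opposite signs, while for other pairs the entry is
        \<open>0\<close> anyway.\<close>
      have "s (vs ! i) * s (vs ! j) = - 1 \<or> A $$ (i, j) = 0"
        using ij f[of "vs ! i" "vs ! j"] by (auto simp: s_def adjacency_matrix_def)
      then show ?thesis
        unfolding laplacian_matrix_entry[OF ij] signless_laplacian_matrix_entry[OF ij False]
        using False by (auto simp: mult.assoc mult.left_commute[of "s _" "A $$ _"])
    qed (use ij s in \<open>simp add: laplacian_matrix_entry mult.assoc
        mult.left_commute[of "s _" "(D + A) $$ _"] del: index_add_mat\<close>)
    finally show "L $$ (i, j) = (S * (D + A) * S) $$ (i, j)" by simp
  qed (use S in \<open>simp_all add: laplacian_matrix_def adjacency_matrix_def\<close>)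
  then have "similar_mat_wit L (D + A) S S"
    by (intro similar_mat_witI[OF SS SS _ laplacian_matrix_carrier Q S S])
  then show ?thesis
    by (intro mat_trace_similar similar_mat_wit_pow)
qed

end

subsection \<open>Coefficients of the Laplacian polynomial\<close>

text \<open>For \<open>k \<le> n\<close>, \<open>c (n - k)\<close> is the elementary symmetric
  function of degree \<open>k\<close> in the Laplacian eigenvalues; the bounds on \<open>n\<close>
  keep the subtraction from being truncated. The last trace for the sixth coefficient carries the
  corrected inner signs.\<close>

theorem theorem3p5:
  fixes V :: "'a set" and E :: "'a set set"
    and vs :: "'a list" and es :: "'a set list"
    and n :: nat and A A1 :: "real mat" and c :: "nat \<Rightarrow> real"
  assumes "simple_graph V E" and "card V = n"
    and "distinct vs" and "set vs = V"
    and "distinct es" and "set es = E"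
    and "A = adjacency_matrix vs E"
    and "A1 = adjacency_matrix es (line_graph_edges E)"
    and "char_poly (laplacian_matrix vs E) = (\<Sum>k = 0..n. monom ((-1) ^ (n - k) * c k) k)"
  shows "(1 \<le> n \<longrightarrow> c (n - 1) = mat_trace (A ^\<^sub>m 2)) \<and>
    (2 \<le> n \<longrightarrow> c (n - 2) = 1 / 2 * (
          (\<Prod>i = 0..1. mat_trace (A ^\<^sub>m 2) - 2 * real i) - mat_trace (A1 ^\<^sub>m 2))) \<and>
    (3 \<le> n \<longrightarrow> c (n - 3) = 1 / fact 3 * (
          (\<Prod>i = 0..2. mat_trace (A ^\<^sub>m 2) - 2 * real i)
          - 3 * mat_trace (A ^\<^sub>m 2) * mat_trace (A1 ^\<^sub>m 2)
          + mat_trace (12 \<cdot>\<^sub>m A1 ^\<^sub>m 2 + 2 \<cdot>\<^sub>m A1 ^\<^sub>m 3)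
          - 4 * mat_trace (A ^\<^sub>m 3))) \<and>
    (forest_graph V E \<longrightarrow> 4 \<le> n \<longrightarrow> c (n - 4) = 1 / fact 4 * (
          (\<Prod>i = 0..3. mat_trace (A ^\<^sub>m 2) - 2 * real i)
          - 6 * (mat_trace (A ^\<^sub>m 2))\<^sup>2 * mat_trace (A1 ^\<^sub>m 2)
          + mat_trace (A ^\<^sub>m 2) * mat_trace (60 \<cdot>\<^sub>m A1 ^\<^sub>m 2 + 8 \<cdot>\<^sub>m A1 ^\<^sub>m 3)
          - mat_trace (144 \<cdot>\<^sub>m A1 ^\<^sub>m 2 + 48 \<cdot>\<^sub>m A1 ^\<^sub>m 3 + 6 \<cdot>\<^sub>m A1 ^\<^sub>m 4)
          + 3 * (mat_trace (A1 ^\<^sub>m 2))\<^sup>2)) \<and>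
    (forest_graph V E \<longrightarrow> 5 \<le> n \<longrightarrow> c (n - 5) = 1 / fact 5 * (
          (\<Prod>i = 0..4. mat_trace (A ^\<^sub>m 2) - 2 * real i)
          - 10 * (mat_trace (A ^\<^sub>m 2)) ^ 3 * mat_trace (A1 ^\<^sub>m 2)
          + (mat_trace (A ^\<^sub>m 2))\<^sup>2 * mat_trace (180 \<cdot>\<^sub>m A1 ^\<^sub>m 2 + 20 \<cdot>\<^sub>m A1 ^\<^sub>m 3)
          - mat_trace (A ^\<^sub>m 2) * mat_trace (1040 \<cdot>\<^sub>m A1 ^\<^sub>m 2 + 280 \<cdot>\<^sub>m A1 ^\<^sub>m 3 + 30 \<cdot>\<^sub>m A1 ^\<^sub>m 4)
          + 15 * mat_trace (A ^\<^sub>m 2) * (mat_trace (A1 ^\<^sub>m 2))\<^sup>2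
          - mat_trace (A1 ^\<^sub>m 2) * mat_trace (120 \<cdot>\<^sub>m A1 ^\<^sub>m 2 + 20 \<cdot>\<^sub>m A1 ^\<^sub>m 3)
          + mat_trace (1920 \<cdot>\<^sub>m A1 ^\<^sub>m 2 + 960 \<cdot>\<^sub>m A1 ^\<^sub>m 3 + 240 \<cdot>\<^sub>m A1 ^\<^sub>m 4 + 24 \<cdot>\<^sub>m A1 ^\<^sub>m 5))) \<and>
    (forest_graph V E \<longrightarrow> 6 \<le> n \<longrightarrow> c (n - 6) = 1 / fact 6 * (
          (\<Prod>i = 0..5. mat_trace (A ^\<^sub>m 2) - 2 * real i)
          - 15 * (mat_trace (A ^\<^sub>m 2)) ^ 4 * mat_trace (A1 ^\<^sub>m 2)
          + (mat_trace (A ^\<^sub>m 2)) ^ 3 * mat_trace (420 \<cdot>\<^sub>m A1 ^\<^sub>m 2 + 40 \<cdot>\<^sub>m A1 ^\<^sub>m 3)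
          - (mat_trace (A ^\<^sub>m 2))\<^sup>2 * mat_trace (4260 \<cdot>\<^sub>m A1 ^\<^sub>m 2 + 960 \<cdot>\<^sub>m A1 ^\<^sub>m 3 + 90 \<cdot>\<^sub>m A1 ^\<^sub>m 4)
          + 45 * (mat_trace (A ^\<^sub>m 2) * mat_trace (A1 ^\<^sub>m 2))\<^sup>2
          - 810 * mat_trace (A ^\<^sub>m 2) * (mat_trace (A1 ^\<^sub>m 2))\<^sup>2
          + mat_trace (A ^\<^sub>m 2) * mat_trace (18480 \<cdot>\<^sub>m A1 ^\<^sub>m 2 + 7520 \<cdot>\<^sub>m A1 ^\<^sub>m 3 + 1620 \<cdot>\<^sub>m A1 ^\<^sub>m 4 + 144 \<cdot>\<^sub>m A1 ^\<^sub>m 5)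
          - 15 * (mat_trace (A1 ^\<^sub>m 2)) ^ 3
          + 3600 * (mat_trace (A1 ^\<^sub>m 2))\<^sup>2
          - 28800 * mat_trace (A1 ^\<^sub>m 2)
          + mat_trace (A1 ^\<^sub>m 2) * mat_trace (1200 \<cdot>\<^sub>m A1 ^\<^sub>m 3 + 90 \<cdot>\<^sub>m A1 ^\<^sub>m 4)
          + 40 * (mat_trace (A1 ^\<^sub>m 3))\<^sup>2
          - 120 * mat_trace (A ^\<^sub>m 2) * mat_trace (A1 ^\<^sub>m 2) * mat_trace (A1 ^\<^sub>m 3)
          - mat_trace (19200 \<cdot>\<^sub>m A1 ^\<^sub>m 3 + 7200 \<cdot>\<^sub>m A1 ^\<^sub>m 4 + 1440 \<cdot>\<^sub>m A1 ^\<^sub>m 5 + 120 \<cdot>\<^sub>m A1 ^\<^sub>m 6)))"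
proof -
  interpret enumerated_graph V E vs es
    using assms by unfold_locales auto
  have n: "length vs = n"
    using assms distinct_card by fastforce
  let ?L = "laplacian_matrix vs E"
  \<comment> \<open>Everything is reduced to polynomial identities in \<open>t\<close>,
    \<open>u\<close> and \<open>T 2\<close> to \<open>T 6\<close>; \<open>p\<close> and
    \<open>q\<close> are the power sums belonging to \<open>D - A\<close> and
    \<open>D + A\<close>.\<close>
  define t where "t = mat_trace (A ^\<^sub>m 2)"
  define u where "u = mat_trace (A ^\<^sub>m 3)"
  define T where "T j = mat_trace (A1 ^\<^sub>m j)" for j
  define p where "p j = mat_trace (?L ^\<^sub>m j)" for j
  define q where "q j = mat_trace ((degree_matrix vs E + A) ^\<^sub>m j)" for j
  have L: "?L \<in> carrier_mat n n"
    using laplacian_matrix_carrier[of vs E] n by simp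
  have A1: "A1 \<in> carrier_mat (length es) (length es)"
    using adjacency_matrix_carrier assms by simp
  have coeff: "coeff (char_poly ?L) (n - k) = (-1) ^ k * c (n - k)" if "k \<le> n" for k
    using that by (simp add: assms coeff_sum)
  have c0: "c n = 1"
    using coeff[of 0] degree_monic_char_poly[OF L] by simp
  \<comment> \<open>Cancelling the common sign \<open>(-1) ^ k\<close> leaves Newton's identities
    between elementary symmetric functions and power sums.\<close>
  have newton: "real k * c (n - k) = (\<Sum>i = 1..k. (-1) ^ Suc i * c (n - (k - i)) * p i)"
    if "k \<le> n" for k
  proof -
    have "(-1) ^ k * (real k * c (n - k)) = - (\<Sum>i = 1..k. (-1) ^ (k - i) * c (n - (k - i)) * p i)"
      using newton_char_poly[OF L that] that
      by (simp only: coeff p_def diff_le_self le_trans) (simp add: mult_ac)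
    also have "\<dots> = (-1) ^ k * (\<Sum>i = 1..k. (-1) ^ Suc i * c (n - (k - i)) * p i)"
      unfolding sum_distrib_left sum_negf[symmetric]
      by (intro sum.cong) (auto simp: minus_one_power_iff)
    finally show ?thesis by simp
  qed
  have t: "t = 2 * real (length es)"
    unfolding t_def assms by (rule mat_trace_adjacency_pow2)
  \<comment> \<open>The power with exponent \<open>0\<close> is the identity matrix of size
    \<open>length es\<close>, and \<open>t\<close> is twice that size.\<close>
  have T0: "T 0 = t / 2"
    using A1 by (simp add: T_def t mat_trace_def)
  have T1: "T 1 = 0"
    using A1 mat_trace_line_adjacency by (simp add: T_def assms)
  have q: "q k = (\<Sum>i\<le>k. real (k choose i) * 2 ^ (k - i) * T i)" if "k \<noteq> 0" for k
    using mat_trace_signless_laplacian_pow[OF that] mat_trace_binomial[OF A1, of 2 k]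
    by (simp add: q_def T_def assms)
  have q1: "q (Suc 0) = t" and q2: "q 2 = 2 * t + T 2"
    and q3: "q 3 = 4 * t + 6 * T 2 + T 3"
    and q4: "q 4 = 8 * t + 24 * T 2 + 8 * T 3 + T 4"
    and q5: "q 5 = 16 * t + 80 * T 2 + 40 * T 3 + 10 * T 4 + T 5"
    and q6: "q 6 = 32 * t + 240 * T 2 + 160 * T 3 + 60 * T 4 + 12 * T 5 + T 6"
    using T0 T1 by (simp_all add: q eval_nat_numeral)
  have p1: "p (Suc 0) = q (Suc 0)"
    using mat_trace_laplacian L n adjacency_matrix_carrier[of vs E] by (simp add: p_def q_def assms)
  have p2: "p 2 = q 2"
    using mat_trace_laplacian_pow2 by (simp add: p_def q_def assms)
  have p3: "p 3 = q 3 - 2 * u"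
    using mat_trace_laplacian_pow3 by (simp add: p_def q_def u_def assms)
  have forest: "p k = q k" if "forest_graph V E" for k
    using forest_mat_trace_laplacian_pow[OF that] by (simp add: p_def q_def assms)
  have c1: "c (n - Suc 0) = t" if "Suc 0 \<le> n"
    using newton[of 1] that c0 p1 q1 by simp
  have c2: "2 * c (n - 2) = c (n - Suc 0) * p (Suc 0) - p 2" if "2 \<le> n"
    using newton[of 2] that c0 by (simp add: numeral_2_eq_2)
  have c3: "3 * c (n - 3) = c (n - 2) * p (Suc 0) - c (n - Suc 0) * p 2 + p 3" if "3 \<le> n"
    using newton[of 3] that c0 by (simp add: eval_nat_numeral)
  have c4: "4 * c (n - 4) = c (n - 3) * p (Suc 0) - c (n - 2) * p 2 + c (n - Suc 0) * p 3 - p 4" if "4 \<le> n"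
    using newton[of 4] that c0 by (simp add: eval_nat_numeral)
  have c5: "5 * c (n - 5) = c (n - 4) * p (Suc 0) - c (n - 3) * p 2 + c (n - 2) * p 3 - c (n - Suc 0) * p 4 + p 5"
    if "5 \<le> n"
    using newton[of 5] that c0 by (simp add: eval_nat_numeral)
  have c6: "6 * c (n - 6) = c (n - 5) * p (Suc 0) - c (n - 4) * p 2 + c (n - 3) * p 3 - c (n - 2) * p 4
      + c (n - Suc 0) * p 5 - p 6" if "6 \<le> n"
    using newton[of 6] that c0 by (simp add: eval_nat_numeral)
  \<comment> \<open>From here on, each coefficient \<open>c (n - k)\<close> is multiplied by
    \<open>k!\<close>, which keeps the recursion free of fractions. In the rescaled identities the
    summand with \<open>p i\<close> gets the factor \<open>(k - 1)! / (k - i)!\<close>.\<close>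
  have e2: "2 * c (n - 2) = t * (t - 2) - T 2" if "2 \<le> n"
    using c2 c1 that p1 q1 p2 q2 by (simp add: algebra_simps)
  have e3: "6 * c (n - 3) = t * (t - 2) * (t - 4) - 3 * t * T 2 + (12 * T 2 + 2 * T 3) - 4 * u"
    if "3 \<le> n"
  proof -
    have "6 * c (n - 3) = (2 * c (n - 2)) * p (Suc 0) - 2 * c (n - Suc 0) * p 2 + 2 * p 3"
      using c3[OF that] by simp
    then show ?thesis
      using that by (simp add: e2 c1 p1 q1 p2 q2 p3 q3 algebra_simps)
  qed
  have e4: "24 * c (n - 4) = t * (t - 2) * (t - 4) * (t - 6) - 6 * t\<^sup>2 * T 2
      + t * (60 * T 2 + 8 * T 3) - (144 * T 2 + 48 * T 3 + 6 * T 4) + 3 * (T 2)\<^sup>2"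
    if "forest_graph V E" "4 \<le> n"
  proof -
    \<comment> \<open>A forest has no triangles; here this follows by comparing
      \<open>p 3 = q 3\<close> with the general value \<open>q 3 - 2 * u\<close>.\<close>
    have "u = 0" using forest[OF that(1), of 3] p3 by simp
    have "24 * c (n - 4) = (6 * c (n - 3)) * p (Suc 0) - 3 * (2 * c (n - 2)) * p 2 + 6 * c (n - Suc 0) * p 3
        - 6 * p 4"
      using c4[OF that(2)] by simp
    then show ?thesis
      using that(2)
      by (simp add: e2 e3 c1 forest[OF that(1)] q1 q2 q3 q4 \<open>u = 0\<close> algebra_simps power2_eq_square)
  qed
  have e5: "120 * c (n - 5) = t * (t - 2) * (t - 4) * (t - 6) * (t - 8) - 10 * t ^ 3 * T 2
      + t\<^sup>2 * (180 * T 2 + 20 * T 3) - t * (1040 * T 2 + 280 * T 3 + 30 * T 4)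
      + 15 * t * (T 2)\<^sup>2 - T 2 * (120 * T 2 + 20 * T 3)
      + (1920 * T 2 + 960 * T 3 + 240 * T 4 + 24 * T 5)"
    if "forest_graph V E" "5 \<le> n"
  proof -
    have "u = 0" using forest[OF that(1), of 3] p3 by simp
    have "120 * c (n - 5) = (24 * c (n - 4)) * p (Suc 0) - 4 * (6 * c (n - 3)) * p 2
        + 12 * (2 * c (n - 2)) * p 3 - 24 * c (n - Suc 0) * p 4 + 24 * p 5"
      using c5[OF that(2)] by simp
    then show ?thesis
      using that(2)
      by (simp add: e2 e3 e4[OF that(1)] c1 forest[OF that(1)] q1 q2 q3 q4 q5 \<open>u = 0\<close>
          algebra_simps power2_eq_square power3_eq_cube)
  qed
  have e6: "720 * c (n - 6) = t * (t - 2) * (t - 4) * (t - 6) * (t - 8) * (t - 10) - 15 * t ^ 4 * T 2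
      + t ^ 3 * (420 * T 2 + 40 * T 3) - t\<^sup>2 * (4260 * T 2 + 960 * T 3 + 90 * T 4)
      + 45 * (t * T 2)\<^sup>2 - 810 * t * (T 2)\<^sup>2
      + t * (18480 * T 2 + 7520 * T 3 + 1620 * T 4 + 144 * T 5)
      - 15 * (T 2) ^ 3 + 3600 * (T 2)\<^sup>2 - 28800 * T 2 + T 2 * (1200 * T 3 + 90 * T 4)
      + 40 * (T 3)\<^sup>2 - 120 * t * T 2 * T 3
      - (19200 * T 3 + 7200 * T 4 + 1440 * T 5 + 120 * T 6)"
    if "forest_graph V E" "6 \<le> n"
  proof -
    have "u = 0" using forest[OF that(1), of 3] p3 by simp
    have "720 * c (n - 6) = (120 * c (n - 5)) * p (Suc 0) - 5 * (24 * c (n - 4)) * p 2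
        + 20 * (6 * c (n - 3)) * p 3 - 60 * (2 * c (n - 2)) * p 4 + 120 * c (n - Suc 0) * p 5 - 120 * p 6"
      using c6[OF that(2)] by simp
    moreover have le: "5 \<le> n" "4 \<le> n" "3 \<le> n" "2 \<le> n" "Suc 0 \<le> n"
      using that(2) by simp_all
    ultimately show ?thesis
      unfolding e5[OF that(1) le(1)] e4[OF that(1) le(2)] e3[OF le(3)] e2[OF le(4)] c1[OF le(5)]
        forest[OF that(1)] q1 q2 q3 q4 q5 q6 \<open>u = 0\<close>
      by (simp add: algebra_simps power2_eq_square power3_eq_cube power4_eq_xxxx)
  qed
  note traces = mat_trace_add[where n = "length es"] mat_trace_smult[where n = "length es"]
    pow_carrier_mat[OF A1] T_def
  have range: "{0..1} = {0, 1 :: nat}" "{0..2} = {0, 1, 2 :: nat}" "{0..3} = {0, 1, 2, 3 :: nat}"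
    "{0..4} = {0, 1, 2, 3, 4 :: nat}" "{0..5} = {0, 1, 2, 3, 4, 5 :: nat}"
    by auto
  \<comment> \<open>Clears the factorials, so that the goals match the rescaled identities
    \<open>e2\<close> to \<open>e6\<close>.\<close>
  have divide: "x = 1 / d * y" if "d * x = y" "d \<noteq> 0" for d x y :: real
    using that by auto
  show ?thesis
    unfolding t_def[symmetric] u_def[symmetric] range
  \<comment> \<open>The even-numbered goals are the rescaled identities; the odd ones after the
    first only say that the denominators are nonzero.\<close>
  proof (intro conjI impI divide, goal_cases)
    case 1
    then show ?case using c1 by simp
  next
    case 2
    then show ?case using e2 by (simp add: T_def)
  next
    case 4
    then show ?case using e3 by (simp add: traces fact_numeral mult.assoc)
  next
    case 6
    then show ?case using e4 by (simp add: traces fact_numeral mult.assoc)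
  next
    case 8
    then show ?case using e5 by (simp add: traces fact_numeral mult.assoc)
  next
    case 10
    then show ?case using e6 by (simp add: traces fact_numeral mult.assoc)
  qed simp_all
qed

end
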